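(* Let $H$ be a finite, connected, simple graph with $N$ vertices and largest degree $\delta\ge2$, and let $\beta_1\ge\beta_2\ge\dots\ge\beta_N$ be the eigenvalues (with multiplicity, in decreasing order) of the transition matrix $A$ of the regularised random walk on $H$. Let $\nu=\frac{1}{(\delta-1)\ln 16}$. Then for every $B\in\{0,\dots,N-2\}$, $$\beta_{B+2}\;\le\;1-\frac{4}{\delta N^2}\left(\frac{B+1}{2}\right)^{2\nu}.$$
   Context: The regularised random walk on a finite simple graph $H$ with maximum degree $\delta$ is the simple random walk on the graph obtained from $H$ by attaching loops to vertices (each loop increasing the degree of its vertex by one) until every vertex has degree $\delta$. If $H$ has adjacency matrix $\mathcal A$ and diagonal degree matrix $D$, its transition matrix is $A=\delta^{-1}(\mathcal A+\delta I-D)$. *)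

theory Defs
  imports
    Complex_Main
    "Graph_Theory.Digraph_Component"
    "Jordan_Normal_Form.Char_Poly"
begin

text \<open>
  A finite simple graph is a \<^locale>\<open>pair_graph\<close>: finitely many vertices and a symmetric,
  irreflexive arc relation. Each edge is a pair of opposite arcs, so the degree of a vertex is
  its out-degree.
\<close>

definition max_degree :: "'a pair_pre_digraph \<Rightarrow> nat" where
  "max_degree H = Max (out_degree (with_proj H) ` pverts H)"

text \<open>
  Below, \<open>vs\<close> lists the vertices of \<open>H\<close> without repetition and so fixes the numbering of rows
  and columns.
\<close>

definition adjacency_matrix :: "'a pair_pre_digraph \<Rightarrow> 'a list \<Rightarrow> real mat" where
  "adjacency_matrix H vs = mat (length vs) (length vs)
     (\<lambda>(i, j). if (vs ! i, vs ! j) \<in> parcs H then 1 else 0)"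

definition degree_matrix :: "'a pair_pre_digraph \<Rightarrow> 'a list \<Rightarrow> real mat" where
  "degree_matrix H vs = mat (length vs) (length vs)
     (\<lambda>(i, j). if i = j then real (out_degree (with_proj H) (vs ! i)) else 0)"

definition regularised_walk_matrix :: "'a pair_pre_digraph \<Rightarrow> 'a list \<Rightarrow> real mat" where
  "regularised_walk_matrix H vs =
     (1 / real (max_degree H)) \<cdot>\<^sub>m
       (adjacency_matrix H vs + real (max_degree H) \<cdot>\<^sub>m 1\<^sub>m (length vs) - degree_matrix H vs)"

text \<open>
  \<open>regularised_walk_matrix H vs\<close> is the transition matrix of the simple random walk on \<open>H\<close> with
  \<open>max_degree H - deg v\<close> loops attached to each vertex \<open>v\<close>, where each loop counts once
  towards the degree.
\<close>

lemma (in pair_graph) regularised_walk_matrix_entry: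
  assumes vs: "distinct vs" "set vs = pverts G" and ij: "i < length vs" "j < length vs"
  shows "regularised_walk_matrix G vs $$ (i, j) =
    (if i = j then real (max_degree G - out_degree (with_proj G) (vs ! i))
     else if (vs ! i, vs ! j) \<in> parcs G then 1 else 0) / real (max_degree G)"
proof -
  have "out_degree (with_proj G) (vs ! i) \<le> max_degree G"
    unfolding max_degree_def using vs ij pair_finite_verts by (intro Max_ge) auto
  moreover have "(vs ! i, vs ! i) \<notin> parcs G"
    using pair_no_loops by fastforce
  ultimately show ?thesis
    using ij by (auto simp: regularised_walk_matrix_def adjacency_matrix_def degree_matrix_def
      of_nat_diff)
qed

text \<open>
  The real eigenvalues of a matrix in decreasing order, each repeated according to its
  multiplicity as a root of the characteristic polynomial. For a symmetric matrix the list has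
  as many entries as the matrix has rows.
\<close>

definition eigenvalues_decreasing :: "real mat \<Rightarrow> real list" where
  "eigenvalues_decreasing A = rev (sorted_list_of_multiset (proots (char_poly A)))"

end

theory Submission
  imports Defs "Jordan_Normal_Form.Schur_Decomposition" "HOL-Library.Disjoint_Sets"
begin

text \<open>
  On a connected graph with \<open>m\<close> vertices a function \<open>f\<close> of mean zero satisfies
  \<open>\<Sum>(f u - f v)\<^sup>2 \<ge> (4 / m\<^sup>2) \<Sum>(f v)\<^sup>2\<close>, the first sum being over the edges: ordering the
  vertices by the value of \<open>f\<close> reduces this to a path. Every connected graph with \<open>m \<ge> 2\<close>
  vertices and degrees at most \<open>\<delta>\<close> splits into two connected parts with at most
  \<open>(1 - 1 / (2\<delta>)) m\<close> vertices each, so \<open>j\<close> rounds of splitting partition \<open>H\<close> into at most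
  \<open>2 ^ j\<close> connected parts that are singletons or have at most \<open>(1 - 1 / (2\<delta>)) ^ j N\<close> vertices.
  Take \<open>2 ^ j \<le> B + 1 < 2 ^ (j + 1)\<close>. Requiring mean zero on each part imposes at most \<open>B + 1\<close>
  linear constraints, under which the inequalities of the parts add up; the min-max principle turns
  this into a bound for \<open>\<beta>\<close> at \<open>B + 2\<close>.
\<close>

section \<open>Orthogonal diagonalisation and the upper bound of the min-max principle\<close>

section \<open>Eigenvalues of real symmetric matrices\<close>

text \<open>Supplies the change of basis for deflation. Gram-Schmidt keeps the head of its input, so
  a basis completed from \<open>v\<close> becomes an orthogonal family that starts with
  \<open>v\<close>; normalising it only rescales column 0.\<close>

lemma orthonormal_completion:
  fixes v :: "real vec"
  assumes v: "v \<in> carrier_vec n" and v0: "v \<noteq> 0\<^sub>v n"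
  obtains W c where "W \<in> carrier_mat n n" "transpose_mat W * W = 1\<^sub>m n" "col W 0 = c \<cdot>\<^sub>v v"
proof -
  interpret cof_vec_space n "TYPE(real)" .
  define b where "b = basis_completion v"
  define ws where "ws = gram_schmidt n b"
  from basis_completion[OF v v0, folded b_def]
  have dist_b: "distinct b" and indep: "\<not> lin_dep (set b)" and b: "set b \<subseteq> carrier_vec n"
    and hdb: "hd b = v" and len_b: "length b = n" by auto
  have n: "n \<noteq> 0" using v v0 by (metis eq_vecI carrier_vecD index_zero_vec(2) not_less_zero)
  from hdb len_b n obtain vs where bv: "b = v # vs" by (cases b, auto)
  from gram_schmidt_result[OF b dist_b indep refl, folded ws_def]
  have ws: "set ws \<subseteq> carrier_vec n" "corthogonal ws" "length ws = n"
    by (auto simp: len_b)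
  from gram_schmidt_hd[OF v, of vs, folded bv] have hdws: "ws ! 0 = v"
    unfolding ws_def[symmetric] using ws(3) n by (metis hd_conv_nth length_0_conv)
  define us where "us = map (\<lambda>w. (1 / sqrt (w \<bullet> w)) \<cdot>\<^sub>v w) ws"
  define W where "W = mat_of_cols n us"
  have wc: "ws ! i \<in> carrier_vec n" if "i < n" for i using ws that by auto
  have lenu: "length us = n" using ws by (simp add: us_def)
  have W: "W \<in> carrier_mat n n" unfolding W_def using lenu by (metis mat_of_cols_carrier(1))
  have colW: "col W i = (1 / sqrt (ws ! i \<bullet> ws ! i)) \<cdot>\<^sub>v (ws ! i)" if "i < n" for i
    unfolding W_def using that wc[OF that] lenu ws(3) by (simp add: us_def)
  have orth: "ws ! i \<bullet> ws ! j = 0 \<longleftrightarrow> i \<noteq> j" if "i < n" "j < n" for i j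
    using corthogonalD[OF ws(2), of i j] that ws(3) by simp
  have pos: "ws ! i \<bullet> ws ! i > 0" if "i < n" for i
  proof -
    have "ws ! i \<bullet> ws ! i \<ge> 0" by (auto simp: scalar_prod_def intro!: sum_nonneg)
    then show ?thesis using orth[OF that that] by simp
  qed
  have "transpose_mat W * W = 1\<^sub>m n"
  proof (rule eq_matI)
    fix i j assume ij: "i < dim_row (1\<^sub>m n)" "j < dim_col (1\<^sub>m n)"
    then have ij: "i < n" "j < n" by auto
    have "(transpose_mat W * W) $$ (i, j) = col W i \<bullet> col W j"
      using W ij by (simp add: scalar_prod_def)
    also have "\<dots> = (ws ! i \<bullet> ws ! j) / (sqrt (ws ! i \<bullet> ws ! i) * sqrt (ws ! j \<bullet> ws ! j))"
      using colW[OF ij(1)] colW[OF ij(2)] wc[OF ij(1)] wc[OF ij(2)] by simp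
    also have "\<dots> = 1\<^sub>m n $$ (i, j)"
      using ij orth[OF ij] pos[of i] by (cases "i = j") auto
    finally show "(transpose_mat W * W) $$ (i, j) = 1\<^sub>m n $$ (i, j)" .
  qed (use W in auto)
  moreover have "col W 0 = (1 / sqrt (v \<bullet> v)) \<cdot>\<^sub>v v" using colW[of 0] n hdws by simp
  ultimately show thesis using that W by blast
qed

text \<open>Over the complex numbers the polynomial splits. For an eigenvector \<open>v\<close>,
  moving the matrix across the hermitian product turns \<open>a\<close> into \<open>cnj a\<close>,
  and \<open>v \<bullet>c v\<close> is nonzero, so each root is real. The factorisation then
  descends to the reals by comparing coefficients.\<close>

lemma char_poly_real_symmetric_splits:
  fixes A :: "real mat"
  assumes A: "A \<in> carrier_mat n n" and sym: "transpose_mat A = A"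
  obtains es where "char_poly A = (\<Prod>e\<leftarrow>es. [:- e, 1:])" "length es = n"
proof -
  define C where "C = map_mat complex_of_real A"
  have C: "C \<in> carrier_mat n n" using A by (simp add: C_def)
  from char_poly_factorized[OF C] obtain as
    where as: "char_poly C = (\<Prod>a\<leftarrow>as. [:- a, 1:])" "length as = n" by blast
  have real: "a \<in> \<real>" if "a \<in> set as" for a
  proof -
    have "poly (char_poly C) a = 0"
      using that by (force simp: as poly_prod_list prod_list_zero_iff)
    then have "eigenvalue C a" using eigenvalue_root_char_poly[OF C] by simp
    then obtain v where v: "v \<in> carrier_vec n" "v \<noteq> 0\<^sub>v n" "C *\<^sub>v v = a \<cdot>\<^sub>v v"
      using C by (auto simp: eigenvalue_def eigenvector_def)
    have symC: "transpose_mat C = C" using sym unfolding C_def by (metis map_mat_transpose)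
    have conjC: "conjugate (C *\<^sub>v v) = C *\<^sub>v conjugate v"
    proof (rule eq_vecI)
      fix i assume "i < dim_vec (C *\<^sub>v conjugate v)"
      then have i: "i < n" using C by simp
      then show "conjugate (C *\<^sub>v v) $ i = (C *\<^sub>v conjugate v) $ i"
        using A v(1) by (simp add: C_def scalar_prod_def sum_conjugate)
    qed (use C in simp)
    have "a * (v \<bullet>c v) = (C *\<^sub>v v) \<bullet>c v" using v by simp
    also have "\<dots> = (transpose_mat C *\<^sub>v v) \<bullet> conjugate v" by (simp add: symC)
    also have "\<dots> = v \<bullet> (C *\<^sub>v conjugate v)"
      by (rule transpose_vec_mult_scalar[OF C]) (use v in auto)
    also have "\<dots> = v \<bullet>c (a \<cdot>\<^sub>v v)" using v conjC by metis
    also have "\<dots> = cnj a * (v \<bullet>c v)"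
      using v(1) by (simp add: conjugate_smult_vec)
    finally have "a = cnj a" using v by simp
    then show ?thesis by (metis Reals_cnj_iff)
  qed
  define es where "es = map Re as"
  have as_eq: "as = map of_real es"
    using real by (auto simp: es_def intro!: map_idI[symmetric])
  have "map_poly complex_of_real (char_poly A) = map_poly of_real (\<Prod>e\<leftarrow>es. [:- e, 1:])"
  proof -
    interpret map_poly_comm_ring_hom "of_real :: real \<Rightarrow> complex" ..
    have "map_poly of_real (\<Prod>e\<leftarrow>es. [:- e, 1:]) = (\<Prod>a\<leftarrow>as. [:- a, 1:])"
      unfolding as_eq by (simp add: hom_prod_list o_def)
    then show ?thesis using as(1) of_real_hom.char_poly_hom[OF A] unfolding C_def by metis
  qed
  then have "char_poly A = (\<Prod>e\<leftarrow>es. [:- e, 1:])"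
    by (simp add: poly_eq_iff coeff_map_poly)
  moreover have "length es = n" using as(2) by (simp add: es_def)
  ultimately show thesis by (rule that)
qed

text \<open>Deflation: each induction step splits off one eigenvector. The list \<open>es\<close>
  may come in any order and the diagonal follows it, so a decreasing order can be prescribed
  later.\<close>

theorem spectral_theorem_real_symmetric:
  fixes A :: "real mat"
  assumes "A \<in> carrier_mat n n" "transpose_mat A = A"
    and "char_poly A = (\<Prod>e\<leftarrow>es. [:- e, 1:])"
  shows "\<exists>P \<in> carrier_mat n n. transpose_mat P * P = 1\<^sub>m n \<and>
    transpose_mat P * A * P = mat n n (\<lambda>(i, j). if i = j then es ! i else 0)"
  using assms
proof (induction es arbitrary: n A)
  case Nil
  with degree_monic_char_poly[of A n] have "n = 0" by auto
  then show ?case using Nil by (intro bexI[of _ "1\<^sub>m 0"]) auto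
next
  case (Cons e es)
  note A = Cons.prems(1) and symA = Cons.prems(2) and cp = Cons.prems(3)
  have mon: "monic (\<Prod>e\<leftarrow>es. [:- e, 1:])" by (rule monic_prod_list) auto
  have "degree (char_poly A) = Suc (degree (\<Prod>e\<leftarrow>es. [:- e, 1:]))"
    unfolding cp list.map prod_list.Cons using mon by (subst degree_mult_eq) auto
  with degree_monic_char_poly[OF A] obtain m where n: "n = 1 + m" by (cases n) auto
  have "eigenvalue A e" unfolding eigenvalue_root_char_poly[OF A] cp by simp
  then obtain v where v: "v \<in> carrier_vec n" "v \<noteq> 0\<^sub>v n" "A *\<^sub>v v = e \<cdot>\<^sub>v v"
    using A by (auto simp: eigenvalue_def eigenvector_def)
  obtain W c where W: "W \<in> carrier_mat n n" and WW: "transpose_mat W * W = 1\<^sub>m n"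
    and col0: "col W 0 = c \<cdot>\<^sub>v v"
    using orthonormal_completion[OF v(1,2)] by blast
  have WT: "transpose_mat W \<in> carrier_mat n n" using W by simp
  have WW': "W * transpose_mat W = 1\<^sub>m n" by (rule mat_mult_left_right_inverse[OF WT W WW])
  define A' where "A' = transpose_mat W * A * W"
  have A': "A' \<in> carrier_mat n n" using A W by (simp add: A'_def)
  have symA': "transpose_mat A' = A'"
    unfolding A'_def using A W symA
    by (simp add: transpose_mult[of _ n n _ n] assoc_mult_mat[of _ n n _ n _ n])
  have sim: "similar_mat A' A"
    unfolding similar_mat_def
    by (intro exI, rule similar_mat_witI[of "transpose_mat W" W n]) (use A W A' WW WW' in \<open>auto simp: A'_def\<close>)
  have "A *\<^sub>v col W 0 = e \<cdot>\<^sub>v col W 0"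
    unfolding col0 using v A by (simp add: mult_mat_vec smult_smult_assoc mult.commute)
  moreover have colA': "col A' 0 = transpose_mat W *\<^sub>v (A *\<^sub>v col W 0)"
  proof (rule eq_vecI)
    fix i assume "i < dim_vec (transpose_mat W *\<^sub>v (A *\<^sub>v col W 0))"
    then show "col A' 0 $ i = (transpose_mat W *\<^sub>v (A *\<^sub>v col W 0)) $ i"
      using A W n unfolding A'_def
      by (simp add: assoc_mult_mat[of _ n n _ n _ n] col_mult2[of _ n n _ n]
          mult_mat_vec_def carrier_matD(1)[OF A])
  qed (use W A' in simp)
  moreover have "transpose_mat W *\<^sub>v col W 0 = unit_vec n 0"
    using WW col_mult2[OF WT W, of 0] n by simp
  ultimately have colA: "col A' 0 = e \<cdot>\<^sub>v unit_vec n 0"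
    using mult_mat_vec[OF WT, of "col W 0" e] col_dim[of W 0] W by simp
  have col0A: "A' $$ (i, 0) = (if i = 0 then e else 0)" if "i < n" for i
    using that A' n arg_cong[OF colA, of "\<lambda>v. v $ i"] by simp
  define A3 where "A3 = mat m m (\<lambda>(i, j). A' $$ (Suc i, Suc j))"
  have A3: "A3 \<in> carrier_mat m m" by (simp add: A3_def)
  have symA'_ij: "A' $$ (i, j) = A' $$ (j, i)" if "i < n" "j < n" for i j
    using arg_cong[OF symA', of "\<lambda>B. B $$ (j, i)"] A' that by simp
  have row0A: "A' $$ (0, i) = (if i = 0 then e else 0)" if "i < n" for i
    using col0A[OF that] symA'_ij[of 0 i] that n by simp
  \<comment> \<open>Column 0 is \<open>e\<close> times a unit vector because column 0 of
    \<open>W\<close> is an eigenvector for \<open>e\<close>; row 0 then follows by symmetry.\<close>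
  have block: "A' = four_block_mat (mat 1 1 (\<lambda>_. e)) (0\<^sub>m 1 m) (0\<^sub>m m 1) A3"
    using A' col0A row0A n by (intro eq_matI) (auto simp: A3_def)
  have symA3: "transpose_mat A3 = A3"
    unfolding A3_def by (rule eq_matI) (simp_all add: symA'_ij n)
  have "char_poly A' = [:- e, 1:] * (\<Prod>e\<leftarrow>es. [:- e, 1:])"
    using cp char_poly_similar[OF sim] by simp
  also have "char_poly A' = char_poly (mat 1 1 (\<lambda>_. e)) * char_poly A3"
    unfolding block by (rule char_poly_four_block_zeros_col) (use A3 in auto)
  also have "char_poly (mat 1 1 (\<lambda>_. e)) = [:- e, 1:]"
    by (simp add: char_poly_defs det_def sign_def)
  finally have cp3: "char_poly A3 = (\<Prod>e\<leftarrow>es. [:- e, 1:])"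
    by (metis mult_cancel_left pCons_eq_0_iff zero_neq_one)
  from Cons.IH[OF A3 symA3 cp3] obtain P' where P': "P' \<in> carrier_mat m m"
    and PP': "transpose_mat P' * P' = 1\<^sub>m m"
    and D': "transpose_mat P' * A3 * P' = mat m m (\<lambda>(i, j). if i = j then es ! i else 0)" by blast
  \<comment> \<open>Acts as the identity on the eigenvector already split off and diagonalises the
    remaining block.\<close>
  define R where "R = four_block_mat (1\<^sub>m 1) (0\<^sub>m 1 m) (0\<^sub>m m 1) P'"
  have R: "R \<in> carrier_mat n n" using P' n by (auto simp: R_def)
  have RT: "transpose_mat R = four_block_mat (1\<^sub>m 1) (0\<^sub>m 1 m) (0\<^sub>m m 1) (transpose_mat P')"
    unfolding R_def using P' by (subst transpose_four_block_mat[of _ 1 1 _ m _ m]) auto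
  have mult_block: "four_block_mat X (0\<^sub>m 1 m) (0\<^sub>m m 1) Y * four_block_mat X' (0\<^sub>m 1 m) (0\<^sub>m m 1) Y'
      = four_block_mat (X * X') (0\<^sub>m 1 m) (0\<^sub>m m 1) (Y * Y')"
    if "X \<in> carrier_mat 1 1" "X' \<in> carrier_mat 1 1" "Y \<in> carrier_mat m m" "Y' \<in> carrier_mat m m"
    for X X' Y Y' :: "real mat"
    using that by (subst mult_four_block_mat[of _ 1 1 _ m _ m _ _ 1 _ m]) auto
  have RR: "transpose_mat R * R = 1\<^sub>m n"
  proof -
    have "transpose_mat R * R = four_block_mat (1\<^sub>m 1) (0\<^sub>m 1 m) (0\<^sub>m m 1) (1\<^sub>m m)"
      unfolding RT unfolding R_def by (subst mult_block) (use P' PP' in auto)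
    also have "\<dots> = 1\<^sub>m n" unfolding n by (intro eq_matI) auto
    finally show ?thesis .
  qed
  have RA: "transpose_mat R * A' * R = mat n n (\<lambda>(i, j). if i = j then (e # es) ! i else 0)"
  proof -
    have "transpose_mat R * A' * R
        = four_block_mat (mat 1 1 (\<lambda>_. e)) (0\<^sub>m 1 m) (0\<^sub>m m 1) (transpose_mat P' * A3 * P')"
      unfolding RT block unfolding R_def
      by (subst mult_block, (use P' A3 in auto)[4], subst mult_block) (use P' A3 in auto)
    then show ?thesis unfolding D' using n by (auto intro!: eq_matI)
  qed
  show ?case
  proof (intro bexI conjI)
    show P: "W * R \<in> carrier_mat n n" using W R by simp
    have T: "transpose_mat (W * R) = transpose_mat R * transpose_mat W" using transpose_mult[OF W R] .
    have RTc: "transpose_mat R \<in> carrier_mat n n" using R by simp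
    have "transpose_mat (W * R) * (W * R) = transpose_mat R * (transpose_mat W * W) * R"
      unfolding T using W R WT RTc by (simp add: assoc_mult_mat[of _ n n _ n _ n])
    then show "transpose_mat (W * R) * (W * R) = 1\<^sub>m n" using RTc R by (simp add: WW RR)
    have "transpose_mat (W * R) * A * (W * R) = transpose_mat R * A' * R"
      unfolding T A'_def using W R WT RTc A by (simp add: assoc_mult_mat[of _ n n _ n _ n])
    then show "transpose_mat (W * R) * A * (W * R)
        = mat n n (\<lambda>(i, j). if i = j then (e # es) ! i else 0)" using RA by simp
  qed
qed

text \<open>At most \<open>m\<close> linear constraints leave a nonzero vector in the span of the
  first \<open>m + 1\<close> eigenvectors, and on that span the quadratic form is at least
  \<open>es ! m\<close> times the squared norm. Positions start at 0, so \<open>es ! m\<close> is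
  the eigenvalue number \<open>m + 1\<close>.\<close>

lemma courant_fischer_upper:
  fixes A :: "real mat" and L :: "nat \<Rightarrow> real vec"
  assumes A: "A \<in> carrier_mat n n" and sym: "transpose_mat A = A"
    and cp: "char_poly A = (\<Prod>e\<leftarrow>es. [:- e, 1:])" and len: "length es = n"
    and dec: "sorted (rev es)"
    and L: "\<And>i. i < p \<Longrightarrow> L i \<in> carrier_vec n" and pm: "p \<le> m" and mn: "m < n"
    and bound: "\<And>x. x \<in> carrier_vec n \<Longrightarrow> (\<And>i. i < p \<Longrightarrow> L i \<bullet> x = 0) \<Longrightarrow>
      x \<bullet> (A *\<^sub>v x) \<le> c * (x \<bullet> x)"
  shows "es ! m \<le> c"
proof -
  from spectral_theorem_real_symmetric[OF A sym cp] obtain P where P: "P \<in> carrier_mat n n"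
    and PP: "transpose_mat P * P = 1\<^sub>m n"
    and D: "transpose_mat P * A * P = mat n n (\<lambda>(i, j). if i = j then es ! i else 0)" by blast
  \<comment> \<open>A square system for the eigenvector coordinates \<open>z\<close>: rows below
    \<open>p\<close> carry the constraints, rows above \<open>m\<close> kill the later coordinates.
    Since \<open>p \<le> m\<close>, row \<open>m\<close> carries no constraint; as a zero row it
    makes \<open>M\<close> singular, which yields a nonzero solution.\<close>
  define M where "M = mat\<^sub>r n n (\<lambda>i. if i = m then 0\<^sub>v n
      else if i < p then transpose_mat P *\<^sub>v L i else if i < m then 0\<^sub>v n else unit_vec n i)"
  have M: "M \<in> carrier_mat n n" by (simp add: M_def)
  have rowM: "row M i = (if i = m then 0\<^sub>v n
      else if i < p then transpose_mat P *\<^sub>v L i else if i < m then 0\<^sub>v n else unit_vec n i)"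
    if "i < n" for i
    unfolding M_def using that P L by (subst row_mat_of_row_fun) auto
  have "det M = 0"
    unfolding M_def using P L by (intro det_row_0 mn) auto
  then obtain z where z: "z \<in> carrier_vec n" "z \<noteq> 0\<^sub>v n" "M *\<^sub>v z = 0\<^sub>v n"
    using det_0_iff_vec_prod_zero_field[OF M] by blast
  have Mz: "row M i \<bullet> z = 0" if "i < n" for i
    using arg_cong[OF z(3), of "\<lambda>v. v $ i"] that M by simp
  have z0: "z $ i = 0" if "m < i" "i < n" for i
    using Mz[OF that(2)] rowM[OF that(2)] that pm z(1) by simp
  define x where "x = P *\<^sub>v z"
  have x: "x \<in> carrier_vec n" using P z by (simp add: x_def)
  have Lx: "L i \<bullet> x = 0" if "i < p" for i
  proof -
    have "L i \<bullet> x = (transpose_mat P *\<^sub>v L i) \<bullet> z"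
      unfolding x_def using transpose_vec_mult_scalar[OF P z(1) L[OF that]] by simp
    then show ?thesis using Mz[of i] rowM[of i] that pm mn by simp
  qed
  have xx: "x \<bullet> x = (\<Sum>i<n. (z $ i)\<^sup>2)"
  proof -
    have "x \<bullet> x = (transpose_mat P *\<^sub>v x) \<bullet> z"
      using transpose_vec_mult_scalar[OF P z(1) x] by (simp add: x_def)
    also have "transpose_mat P *\<^sub>v x = z"
      unfolding x_def using P PP z by (simp flip: assoc_mult_mat_vec[of _ n n _ n])
    finally show ?thesis using z(1) by (simp add: scalar_prod_def power2_eq_square atLeast0LessThan)
  qed
  have xAx: "x \<bullet> (A *\<^sub>v x) = (\<Sum>i<n. es ! i * (z $ i)\<^sup>2)"
  proof -
    have "x \<bullet> (A *\<^sub>v x) = (A *\<^sub>v x) \<bullet> x"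
      using A x by (intro comm_scalar_prod[of _ n]) auto
    also have "\<dots> = (transpose_mat P *\<^sub>v (A *\<^sub>v x)) \<bullet> z"
      using transpose_vec_mult_scalar[OF P z(1), of "A *\<^sub>v x"] A x by (simp add: x_def)
    also have "transpose_mat P *\<^sub>v (A *\<^sub>v x) = (transpose_mat P * A * P) *\<^sub>v z"
      unfolding x_def using P A z by (simp add: assoc_mult_mat_vec[of _ n n _ n])
    also have "\<dots> = vec n (\<lambda>i. es ! i * z $ i)"
      unfolding D using z(1) by (intro eq_vecI) (auto simp: scalar_prod_def if_distrib[of "\<lambda>a. a * _"] sum.delta' cong: if_cong)
    finally show ?thesis using z(1) by (simp add: scalar_prod_def power2_eq_square atLeast0LessThan mult_ac)
  qed
  have "es ! m * (\<Sum>i<n. (z $ i)\<^sup>2) \<le> (\<Sum>i<n. es ! i * (z $ i)\<^sup>2)"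
    unfolding sum_distrib_left
  proof (rule sum_mono)
    fix i assume "i \<in> {..<n}"
    then have i: "i < n" by simp
    show "es ! m * (z $ i)\<^sup>2 \<le> es ! i * (z $ i)\<^sup>2"
    proof (cases "i \<le> m")
      case True
      then have "es ! m \<le> es ! i" using dec mn len by (simp add: sorted_rev_iff_nth_mono)
      then show ?thesis by (simp add: mult_right_mono)
    qed (use z0 i in simp)
  qed
  also have "\<dots> \<le> c * (\<Sum>i<n. (z $ i)\<^sup>2)"
    using bound[OF x Lx] by (simp add: xx xAx)
  finally have "es ! m * (\<Sum>i<n. (z $ i)\<^sup>2) \<le> c * (\<Sum>i<n. (z $ i)\<^sup>2)" .
  moreover have "(\<Sum>i<n. (z $ i)\<^sup>2) > 0"
  proof -
    obtain i where i: "i < n" "z $ i \<noteq> 0" using z(1,2) by (metis carrier_vecD eq_vecI index_zero_vec)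
    then show ?thesis by (intro sum_pos2[of _ i]) auto
  qed
  ultimately show ?thesis by simp
qed

text \<open>A product of monic linear factors determines the multiset of its roots, so the sorted
  list is a permutation of any list over which the characteristic polynomial splits.\<close>

lemma eigenvalues_decreasing_real_symmetric:
  fixes A :: "real mat"
  assumes A: "A \<in> carrier_mat n n" and sym: "transpose_mat A = A"
  shows "char_poly A = (\<Prod>e\<leftarrow>eigenvalues_decreasing A. [:- e, 1:])"
    and "length (eigenvalues_decreasing A) = n"
    and "sorted (rev (eigenvalues_decreasing A))"
proof -
  obtain es where es: "char_poly A = (\<Prod>e\<leftarrow>es. [:- e, 1:])" "length es = n"
    using char_poly_real_symmetric_splits[OF A sym] by blast
  have "proots (\<Prod>e\<leftarrow>es. [:- e, 1:]) = mset es" for es :: "real list"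
  proof (induction es)
    case (Cons e es)
    have "(\<Prod>e\<leftarrow>es. [:- e, 1:]) \<noteq> 0" by (auto simp: prod_list_zero_iff)
    then show ?case using Cons by (simp add: proots_mult del: mult_pCons_left)
  qed simp
  then have ed: "mset (eigenvalues_decreasing A) = mset es"
    unfolding eigenvalues_decreasing_def es(1) by simp
  then have "mset (map (\<lambda>e. [:- e, 1:]) (eigenvalues_decreasing A)) = mset (map (\<lambda>e. [:- e, 1:]) es)"
    by simp
  then show "char_poly A = (\<Prod>e\<leftarrow>eigenvalues_decreasing A. [:- e, 1:])"
    unfolding es(1) by (metis prod_mset_prod_list)
  show "length (eigenvalues_decreasing A) = n" using ed es(2) by (metis size_mset)
  show "sorted (rev (eigenvalues_decreasing A))" by (simp add: eigenvalues_decreasing_def)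
qed

section \<open>Induced subgraphs, balanced splittings and their iteration\<close>

section \<open>Partitions into connected parts\<close>

text \<open>Paths must stay inside \<open>S\<close>, so this is connectedness of the induced
  subgraph. The empty set counts as connected, which admits the trivial splitting into
  \<open>S\<close> and \<open>{}\<close> as a starting point for minimisation.\<close>

definition connected_on :: "('a \<times> 'a) set \<Rightarrow> 'a set \<Rightarrow> bool" where
  "connected_on E S \<longleftrightarrow> (\<forall>x\<in>S. \<forall>y\<in>S. (x, y) \<in> (E \<inter> S \<times> S)\<^sup>*)"

text \<open>Without an edge leaving \<open>A\<close>, the set \<open>A\<close> would be closed under
  steps inside \<open>S\<close>, and no path from \<open>x\<close> could reach
  \<open>y\<close>.\<close>

lemma connected_on_crossing:
  assumes "connected_on E S" and "A \<subseteq> S" and "x \<in> A" and "y \<in> S - A"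
  shows "\<exists>u\<in>A. \<exists>w\<in>S - A. (u, w) \<in> E"
proof (rule ccontr)
  assume no: "\<not> ?thesis"
  have "(x, y) \<in> (E \<inter> S \<times> S)\<^sup>*" using assms by (auto simp: connected_on_def)
  then have "y \<in> A"
    by (induction rule: rtrancl_induct) (use assms no in auto)
  then show False using assms by simp
qed

lemma connected_onI_root:
  assumes "sym E" and "\<And>y. y \<in> S \<Longrightarrow> (r, y) \<in> (E \<inter> S \<times> S)\<^sup>*"
  shows "connected_on E S"
proof -
  have "sym ((E \<inter> S \<times> S)\<^sup>*)" using assms(1) by (intro sym_rtrancl) (auto simp: sym_def)
  then show ?thesis using assms(2) unfolding connected_on_def by (meson rtrancl_trans symD)
qed

lemma connected_on_glue:
  assumes "sym E" and "connected_on E S" "connected_on E T" and "u \<in> S" "w \<in> T" "(u, w) \<in> E"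
  shows "connected_on E (S \<union> T)"
proof (rule connected_onI_root[OF assms(1), of _ u])
  fix y assume "y \<in> S \<union> T"
  have mono: "(E \<inter> S \<times> S)\<^sup>* \<subseteq> (E \<inter> (S \<union> T) \<times> (S \<union> T))\<^sup>*"
    "(E \<inter> T \<times> T)\<^sup>* \<subseteq> (E \<inter> (S \<union> T) \<times> (S \<union> T))\<^sup>*" by (auto intro!: rtrancl_mono)
  show "(u, y) \<in> (E \<inter> (S \<union> T) \<times> (S \<union> T))\<^sup>*"
  proof (cases "y \<in> S")
    case True
    then have "(u, y) \<in> (E \<inter> S \<times> S)\<^sup>*" using assms by (auto simp: connected_on_def)
    then show ?thesis using mono by blast
  next
    case False
    then have "(w, y) \<in> (E \<inter> T \<times> T)\<^sup>*"
      using assms \<open>y \<in> S \<union> T\<close> by (auto simp: connected_on_def)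
    then have "(w, y) \<in> (E \<inter> (S \<union> T) \<times> (S \<union> T))\<^sup>*" using mono by blast
    moreover have "(u, w) \<in> E \<inter> (S \<union> T) \<times> (S \<union> T)" using assms by simp
    ultimately show ?thesis by (rule converse_rtrancl_into_rtrancl[rotated])
  qed
qed

text \<open>By reflexivity \<open>x\<close> belongs to this set even when it lies outside
  \<open>S\<close>, in which case the set is not contained in \<open>S\<close>.\<close>

definition component_on :: "('a \<times> 'a) set \<Rightarrow> 'a set \<Rightarrow> 'a \<Rightarrow> 'a set" where
  "component_on E S x = (E \<inter> S \<times> S)\<^sup>* `` {x}"

lemma component_on_subset: "x \<in> S \<Longrightarrow> component_on E S x \<subseteq> S"
proof
  fix y assume "x \<in> S" "y \<in> component_on E S x"
  then have "(x, y) \<in> (E \<inter> S \<times> S)\<^sup>*" by (simp add: component_on_def)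
  then show "y \<in> S" using \<open>x \<in> S\<close> by (induction rule: rtrancl_induct) auto
qed

lemma connected_on_component:
  assumes "sym E"
  shows "connected_on E (component_on E S x)"
proof (rule connected_onI_root[OF assms, of _ x])
  let ?C = "component_on E S x"
  fix y assume "y \<in> ?C"
  then have "(x, y) \<in> (E \<inter> S \<times> S)\<^sup>*" by (simp add: component_on_def)
  then show "(x, y) \<in> (E \<inter> ?C \<times> ?C)\<^sup>*"
  proof (induction rule: rtrancl_induct)
    case (step y z)
    then have "(y, z) \<in> E \<inter> ?C \<times> ?C"
      by (auto simp: component_on_def intro: rtrancl_into_rtrancl)
    then show ?case using step by (meson rtrancl_into_rtrancl)
  qed simp
qed

text \<open>A path in \<open>T\<close> from \<open>t\<close> to a vertex outside the component \<open>C\<close> of \<open>T - {t}\<close> can be cut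
  at its last visit to \<open>t\<close>; the rest of it never enters \<open>C\<close>.\<close>

lemma connected_on_minus_component:
  assumes symE: "sym E" and T: "connected_on E T" and t: "t \<in> T" and x: "x \<in> T - {t}"
  shows "connected_on E (T - component_on E (T - {t}) x)"
proof (rule connected_onI_root[OF symE, of _ t])
  let ?C = "component_on E (T - {t}) x" and ?R = "T - component_on E (T - {t}) x"
  have tC: "t \<notin> ?C" using component_on_subset[OF x, of E] by auto
  have closed: "z \<in> ?C" if "y \<in> ?C" "(y, z) \<in> E" "z \<in> T" "z \<noteq> t" for y z
  proof -
    have "y \<in> T - {t}" using component_on_subset[OF x, of E] that by auto
    then show ?thesis using that by (auto simp: component_on_def intro: rtrancl_into_rtrancl)
  qed
  fix y assume y: "y \<in> ?R"
  have "(t, y) \<in> (E \<inter> T \<times> T)\<^sup>*" using T t y by (auto simp: connected_on_def)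
  \<comment> \<open>The invariant along the path: whenever it visits \<open>t\<close> the second
    alternative restarts with the empty path, and a step out of the component can only lead to
    \<open>t\<close>.\<close>
  then have "y \<in> ?C \<or> (t, y) \<in> (E \<inter> ?R \<times> ?R)\<^sup>*"
  proof (induction rule: rtrancl_induct)
    case (step y z)
    show ?case
    proof (cases "z \<in> ?C \<or> z = t")
      case False
      then have "y \<notin> ?C" using closed step by blast
      then have "(y, z) \<in> E \<inter> ?R \<times> ?R" using step False by auto
      then show ?thesis using step \<open>y \<notin> ?C\<close> by (meson rtrancl_into_rtrancl)
    qed auto
  qed simp
  then show "(t, y) \<in> (E \<inter> ?R \<times> ?R)\<^sup>*" using y by simp
qed

text \<open>Connectedness of \<open>T\<close> forces an edge out of the component of
  \<open>x\<close>, and its far end can only be \<open>t\<close>, since any other end would belong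
  to the component. So there are at most as many components as neighbours of \<open>t\<close> in
  \<open>T\<close>.\<close>

lemma component_on_meets_neighbours:
  assumes symE: "sym E" and T: "connected_on E T" and t: "t \<in> T" and x: "x \<in> T - {t}"
  shows "\<exists>w\<in>T - {t}. (t, w) \<in> E \<and> x \<in> component_on E (T - {t}) w"
proof -
  let ?C = "component_on E (T - {t}) x"
  have "x \<in> ?C" by (simp add: component_on_def)
  moreover have sub: "?C \<subseteq> T - {t}" by (rule component_on_subset[OF x])
  ultimately obtain u w where uw: "u \<in> ?C" "w \<in> T - ?C" "(u, w) \<in> E"
    using connected_on_crossing[OF T, of ?C x t] t by blast
  have "w = t"
  proof (rule ccontr)
    assume "w \<noteq> t"
    then have "(u, w) \<in> E \<inter> (T - {t}) \<times> (T - {t})" using uw sub by auto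
    then have "w \<in> ?C" using uw by (auto simp: component_on_def intro: rtrancl_into_rtrancl)
    then show False using uw by simp
  qed
  moreover have "x \<in> component_on E (T - {t}) u"
  proof -
    have "sym ((E \<inter> (T - {t}) \<times> (T - {t}))\<^sup>*)"
      using symE by (intro sym_rtrancl) (auto simp: sym_def)
    then show ?thesis using uw by (auto simp: component_on_def dest: symD)
  qed
  ultimately show ?thesis using uw sub symE by (auto dest: symD)
qed

text \<open>Among all splittings choose one whose larger part \<open>T\<close> is as small as possible. If \<open>t \<in> T\<close>
  is adjacent to the smaller part \<open>U\<close>, then each component \<open>C\<close> of \<open>T - {t}\<close> has at most
  \<open>card U\<close> vertices, as splitting \<open>S\<close> into \<open>C\<close> and \<open>S - C\<close> would otherwise be a better
  choice; and there are at most \<open>d - 1\<close> components, as each contains a neighbour of \<open>t\<close>.\<close>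

lemma balanced_splitting:
  assumes symE: "sym E" and S: "connected_on E S" and fin: "finite S" and m: "card S \<ge> 2"
    and deg: "\<And>x. x \<in> S \<Longrightarrow> finite (E `` {x}) \<and> card (E `` {x}) \<le> d"
  shows "\<exists>T U. T \<union> U = S \<and> T \<inter> U = {} \<and> T \<noteq> {} \<and> U \<noteq> {} \<and> connected_on E T \<and> connected_on E U
    \<and> card S - 1 \<le> d * card T \<and> card S - 1 \<le> d * card U"
proof -
  \<comment> \<open>A splitting is encoded by its larger part alone, the other part being the
    complement.\<close>
  define good where "good T \<longleftrightarrow> T \<subseteq> S \<and> T \<noteq> {} \<and> card (S - T) \<le> card T
    \<and> connected_on E T \<and> connected_on E (S - T)" for T
  have "good S" using S fin m by (auto simp: good_def connected_on_def)
  then obtain T where T: "good T" and min: "\<And>T'. good T' \<Longrightarrow> card T \<le> card T'"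
    using ex_has_least_nat[of good S card] by blast
  define U where "U = S - T"
  have T': "T \<subseteq> S" "T \<noteq> {}" "card U \<le> card T" "connected_on E T" "connected_on E U"
    using T by (auto simp: good_def U_def)
  have finT: "finite T" "finite U" using T' fin finite_subset by (auto simp: U_def)
  have cardS: "card S = card T + card U"
    unfolding U_def using T' fin by (metis card_Diff_subset card_mono finite_subset le_add_diff_inverse)
  \<comment> \<open>At this point \<open>U\<close> may still be empty, the minimum being taken over
    a family that contains \<open>S\<close> itself; the bound on components below rules this
    out.\<close>
  have "\<exists>t\<in>T. U \<noteq> {} \<longrightarrow> (\<exists>u\<in>U. (t, u) \<in> E)"
  proof (cases "U = {}")
    case False
    then obtain a u where "a \<in> T" "u \<in> U" using T' by blast
    then show ?thesis
      using connected_on_crossing[OF S T'(1), of a u] by (auto simp: U_def)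
  qed (use T' in auto)
  then obtain t where t: "t \<in> T" "U \<noteq> {} \<Longrightarrow> \<exists>u\<in>U. (t, u) \<in> E" by blast
  have comp: "card (component_on E (T - {t}) x) \<le> card U" if x: "x \<in> T - {t}" for x
  proof (rule ccontr)
    let ?C = "component_on E (T - {t}) x"
    assume less: "\<not> card ?C \<le> card U"
    have sub: "?C \<subseteq> T - {t}" by (rule component_on_subset[OF x])
    then have CT: "?C \<subseteq> T" "card ?C < card T"
      using finT t by (auto intro!: psubset_card_mono)
    have xC: "x \<in> ?C" by (simp add: component_on_def)
    have conC: "connected_on E ?C" by (rule connected_on_component[OF symE])
    have conR: "connected_on E (S - ?C)"
    proof -
      have conTC: "connected_on E (T - ?C)" by (rule connected_on_minus_component[OF symE T'(4) t(1) x])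
      have tTC: "t \<in> T - ?C" using t sub by auto
      have SC: "S - ?C = (T - ?C) \<union> U" using CT(1) T'(1) by (auto simp: U_def)
      show ?thesis
      proof (cases "U = {}")
        case True then show ?thesis using conTC SC by simp
      next
        case False
        then obtain u where "u \<in> U" "(t, u) \<in> E" using t(2) by blast
        then show ?thesis
          unfolding SC using connected_on_glue[OF symE conTC T'(5) tTC] by blast
      qed
    qed
    have cardR: "card (S - ?C) = card S - card ?C"
      using CT T' fin by (meson card_Diff_subset finite_subset subset_trans)
    have cardCS: "card ?C \<le> card S" using CT cardS by simp
    show False
    \<comment> \<open>The larger of \<open>?C\<close> and its complement would be a better choice
      than \<open>T\<close>: \<open>?C\<close> misses \<open>t\<close>, and its complement has
      \<open>card S - card ?C\<close>, hence fewer than \<open>card S - card U = card T\<close>,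
      vertices.\<close>
    proof (cases "card (S - ?C) \<le> card ?C")
      case True
      then have "good ?C" using CT T' xC conC conR by (auto simp: good_def)
      then show False using min[of ?C] CT by simp
    next
      case False
      have "S - (S - ?C) = ?C" using CT T' by auto
      then have "good (S - ?C)"
        using False conC conR sub t T'(1) by (auto simp: good_def)
      then show False using min[of "S - ?C"] cardR less cardS cardCS by simp
    qed
  qed
  let ?Nb = "{w \<in> T - {t}. (t, w) \<in> E}"
  have finNb: "finite ?Nb" using finT by simp
  have "T - {t} \<subseteq> (\<Union>w\<in>?Nb. component_on E (T - {t}) w)"
    using component_on_meets_neighbours[OF symE T'(4) t(1)] by fast
  moreover have "finite (component_on E (T - {t}) w)" if "w \<in> ?Nb" for w
    using component_on_subset[of w "T - {t}" E] finT that finite_subset by blast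
  ultimately have "card (T - {t}) \<le> card (\<Union>w\<in>?Nb. component_on E (T - {t}) w)"
    using finNb by (intro card_mono) auto
  also have "\<dots> \<le> (\<Sum>w\<in>?Nb. card (component_on E (T - {t}) w))" by (rule card_UN_le[OF finNb])
  also have "\<dots> \<le> (\<Sum>w\<in>?Nb. card U)" by (rule sum_mono) (use comp in auto)
  finally have cT: "card T - 1 \<le> card ?Nb * card U" using t finT by simp
  have dt: "finite (E `` {t})" "card (E `` {t}) \<le> d" using deg t T' by auto
  have Une: "U \<noteq> {}"
  proof
    assume "U = {}"
    then have "card T \<le> 1" using cT by simp
    then show False using cardS m \<open>U = {}\<close> by simp
  qed
  then obtain u where u: "u \<in> U" "(t, u) \<in> E" using t(2) by blast
  \<comment> \<open>The neighbour \<open>u\<close> of \<open>t\<close> lies outside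
    \<open>T\<close>, which leaves at most \<open>d - 1\<close> neighbours inside.\<close>
  have "card (insert u ?Nb) \<le> card (E `` {t})" using dt u by (intro card_mono) auto
  moreover have "u \<notin> ?Nb" using u by (auto simp: U_def)
  ultimately have "card ?Nb + 1 \<le> d" using finNb dt by simp
  then have "(card ?Nb + 1) * card U \<le> d * card U" by (rule mult_right_mono) simp
  moreover have "card T \<ge> 1" using t finT by (metis One_nat_def Suc_leI card_gt_0_iff empty_iff)
  ultimately have U: "card S - 1 \<le> d * card U" using cT cardS by simp
  also have "\<dots> \<le> d * card T" using T' by simp
  finally have "card S - 1 \<le> d * card T" .
  then show ?thesis using U T' Une by (intro exI[of _ T] exI[of _ U]) (auto simp: U_def)
qed

text \<open>Induction on the number of rounds. Singletons cannot be split and need not shrink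
  further; they are harmless later, because a function of mean zero vanishes on them.\<close>

lemma connected_partition:
  assumes "sym E" "connected_on E S" "finite S" "S \<noteq> {}"
    and "\<And>x. x \<in> S \<Longrightarrow> finite (E `` {x}) \<and> card (E `` {x}) \<le> d" and "d > 0"
  shows "\<exists>P. partition_on S P \<and> card P \<le> 2 ^ j \<and>
    (\<forall>T\<in>P. connected_on E T \<and> (card T = 1 \<or> real (card T) \<le> (1 - 1 / (2 * real d)) ^ j * real (card S)))"
  using assms(2-5)
proof (induction j arbitrary: S)
  case 0
  then show ?case by (intro exI[of _ "{S}"]) (auto simp: partition_on_def disjoint_def)
next
  case (Suc j)
  let ?r = "1 - 1 / (2 * real d)"
  have r: "?r \<ge> 0" using assms(6) by (simp add: field_simps)
  show ?case
  proof (cases "card S = 1")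
    case True
    then show ?thesis using Suc.prems
      by (intro exI[of _ "{S}"]) (auto simp: partition_on_def disjoint_def)
  next
    case False
    then have m: "card S \<ge> 2" using Suc.prems
      by (metis One_nat_def card_gt_0_iff le_antisym not_less_eq_eq numeral_2_eq_2 Suc_leI)
    from balanced_splitting[OF assms(1) Suc.prems(1,2) m Suc.prems(4)]
    obtain T U where TU: "T \<union> U = S" "T \<inter> U = {}" "T \<noteq> {}" "U \<noteq> {}"
      "connected_on E T" "connected_on E U"
      "card S - 1 \<le> d * card T" "card S - 1 \<le> d * card U" by blast
    have fin: "finite T" "finite U" using TU Suc.prems by auto
    have cardS: "card S = card T + card U" using TU(1,2) fin card_Un_disjoint by metis
    \<comment> \<open>For \<open>card S \<ge> 2\<close> we have
      \<open>card S - 1 \<ge> card S / 2\<close>, so each part takes at least the fraction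
      \<open>1 / (2 * d)\<close> of the vertices, and this is what the other part lacks.\<close>
    have shrink: "real X \<le> ?r * real (card S)" if "card S - 1 \<le> d * Y" "card S = X + Y" for X Y
    proof -
      have "real (card S) \<le> 2 * real (card S - 1)" using m by simp
      also have "\<dots> \<le> 2 * (real d * real Y)"
        using that(1) by (metis mult_left_mono of_nat_le_iff of_nat_mult zero_le_numeral)
      finally have "real (card S) / (2 * real d) \<le> real Y" using assms(6) by (simp add: field_simps)
      then show ?thesis using that(2) by (simp add: algebra_simps)
    qed
    have "\<exists>P. partition_on T P \<and> card P \<le> 2 ^ j \<and>
      (\<forall>X\<in>P. connected_on E X \<and> (card X = 1 \<or> real (card X) \<le> ?r ^ j * real (card T)))"
      using TU fin by (intro Suc.IH Suc.prems(4)) auto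
    then obtain P where P: "partition_on T P" "card P \<le> 2 ^ j"
      "\<And>X. X \<in> P \<Longrightarrow> connected_on E X \<and> (card X = 1 \<or> real (card X) \<le> ?r ^ j * real (card T))" by blast
    have "\<exists>Q. partition_on U Q \<and> card Q \<le> 2 ^ j \<and>
      (\<forall>X\<in>Q. connected_on E X \<and> (card X = 1 \<or> real (card X) \<le> ?r ^ j * real (card U)))"
      using TU fin by (intro Suc.IH Suc.prems(4)) auto
    then obtain Q where Q: "partition_on U Q" "card Q \<le> 2 ^ j"
      "\<And>X. X \<in> Q \<Longrightarrow> connected_on E X \<and> (card X = 1 \<or> real (card X) \<le> ?r ^ j * real (card U))" by blast
    have part: "partition_on S (P \<union> Q)"
    proof -
      have "disjoint (P \<union> Q)"
        using P(1) Q(1) TU(2) unfolding partition_on_def by (intro disjoint_union) auto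
      then show ?thesis using P(1) Q(1) TU(1) by (auto simp: partition_on_def)
    qed
    have "card (P \<union> Q) \<le> card P + card Q" by (rule card_Un_le)
    also have "\<dots> \<le> 2 ^ Suc j" using P(2) Q(2) by simp
    finally have "card (P \<union> Q) \<le> 2 ^ Suc j" .
    moreover have "connected_on E X \<and> (card X = 1 \<or> real (card X) \<le> ?r ^ Suc j * real (card S))"
      if X: "X \<in> P \<union> Q" for X
    proof -
      have "?r ^ j * real (card T) \<le> ?r ^ j * (?r * real (card S))"
        using shrink[of "card U" "card T"] TU(8) cardS r by (intro mult_left_mono) auto
      moreover have "?r ^ j * real (card U) \<le> ?r ^ j * (?r * real (card S))"
        using shrink[of "card T" "card U"] TU(7) cardS r by (intro mult_left_mono) auto
      ultimately show ?thesis using X P(3)[of X] Q(3)[of X] by (auto simp: mult_ac)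
    qed
    ultimately show ?thesis using part by blast
  qed
qed

section \<open>Discrete Poincare inequalities: monotone sequences, connected graphs,
  partitions\<close>

section \<open>A Poincare inequality for connected graphs\<close>

lemma sum_squares_le_square_sum:
  fixes d :: "'a \<Rightarrow> real"
  assumes "finite J" "\<And>k. k \<in> J \<Longrightarrow> d k \<ge> 0"
  shows "(\<Sum>k\<in>J. (d k)\<^sup>2) \<le> (\<Sum>k\<in>J. d k)\<^sup>2"
  using assms
proof (induction J rule: finite_induct)
  case (insert a J)
  then have "0 \<le> 2 * d a * (\<Sum>k\<in>J. d k)" by (simp add: sum_nonneg)
  then show ?case using insert by (simp add: power2_sum)
qed simp

text \<open>Serves twice: for mean zero it expresses the sum of squares by all pairs, and since the
  left side is nonnegative it is the Cauchy-Schwarz inequality against the constant 1.\<close>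

lemma sum_pairwise_differences:
  fixes g :: "'a \<Rightarrow> real"
  shows "(\<Sum>i\<in>J. \<Sum>j\<in>J. (g i - g j)\<^sup>2) = 2 * (real (card J) * (\<Sum>i\<in>J. (g i)\<^sup>2) - (\<Sum>i\<in>J. g i)\<^sup>2)"
proof -
  have "(\<Sum>i\<in>J. \<Sum>j\<in>J. (g i - g j)\<^sup>2) = (\<Sum>i\<in>J. \<Sum>j\<in>J. (g i)\<^sup>2 + (g j)\<^sup>2 - 2 * (g i * g j))"
    by (simp add: power2_diff mult.assoc)
  also have "\<dots> = 2 * (real (card J) * (\<Sum>i\<in>J. (g i)\<^sup>2)) - 2 * (\<Sum>i\<in>J. \<Sum>j\<in>J. g i * g j)"
    by (simp add: sum.distrib sum_subtractf flip: sum_distrib_left)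
  also have "(\<Sum>i\<in>J. \<Sum>j\<in>J. g i * g j) = (\<Sum>i\<in>J. g i)\<^sup>2"
    by (simp add: power2_eq_square sum_product)
  finally show ?thesis by simp
qed

text \<open>The sum over \<open>F\<close> is bounded below and the sum over all pairs above by the path with the
  same values: writing a difference \<open>g j - g i\<close> as a sum of gaps, a gap occurs in at least one
  edge of \<open>F\<close> in each direction, and in at most \<open>n\<^sup>2 / 2\<close> ordered pairs.\<close>

lemma poincare_monotone:
  fixes g :: "nat \<Rightarrow> real"
  assumes mono: "\<And>i j. i \<le> j \<Longrightarrow> j < n \<Longrightarrow> g i \<le> g j"
    and F: "F \<subseteq> {..<n} \<times> {..<n}" and symF: "sym F"
    and cross: "\<And>k. Suc k < n \<Longrightarrow> \<exists>i j. (i, j) \<in> F \<and> i \<le> k \<and> k < j"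
    and zero: "(\<Sum>i<n. g i) = 0"
  shows "8 * (\<Sum>i<n. (g i)\<^sup>2) \<le> (real n)\<^sup>2 * (\<Sum>(i, j)\<in>F. (g i - g j)\<^sup>2)"
proof (cases "n = 0")
  case False
  define d where "d k = g (Suc k) - g k" for k
  define K where "K = {..<n - 1}"
  \<comment> \<open>Exactly the gaps \<open>d k\<close> with \<open>sep k p\<close> add up to the
    absolute difference along \<open>p\<close>; both orientations of a pair count, as they do in
    \<open>F\<close>.\<close>
  define sep where "sep k p \<longleftrightarrow> (fst p \<le> k \<and> k < snd p) \<or> (snd p \<le> k \<and> k < fst p)" for k and p :: "nat \<times> nat"
  define Q where "Q = {..<n} \<times> {..<n}"
  have finQ: "finite Q" by (simp add: Q_def)
  have finF: "finite F" using F finite_subset by blast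
  have d0: "d k \<ge> 0" if "k \<in> K" for k using that mono[of k "Suc k"] by (auto simp: d_def K_def)
  have J: "(g (fst p) - g (snd p))\<^sup>2 = (\<Sum>k\<in>{k \<in> K. sep k p}. d k)\<^sup>2 \<and> card {k \<in> K. sep k p} \<le> n"
    if p: "p \<in> Q" for p
  proof -
    have *: "(\<Sum>k\<in>{k \<in> K. sep k p}. d k) = \<bar>g (fst p) - g (snd p)\<bar>"
    proof -
      define a where "a = min (fst p) (snd p)"
      define b where "b = max (fst p) (snd p)"
      have "a \<le> b" "b < n" using p by (auto simp: a_def b_def Q_def)
      then have "{k \<in> K. sep k p} = {a..<b}" by (auto simp: a_def b_def K_def sep_def)
      then have "(\<Sum>k\<in>{k \<in> K. sep k p}. d k) = g b - g a"
        using sum_Suc_diff'[OF \<open>a \<le> b\<close>, of g] by (simp add: d_def)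
      also have "\<dots> = \<bar>g (fst p) - g (snd p)\<bar>"
        using mono[OF \<open>a \<le> b\<close> \<open>b < n\<close>] by (auto simp: a_def b_def max_def min_def split: if_splits)
      finally show ?thesis .
    qed
    have "card {k \<in> K. sep k p} \<le> card K" by (intro card_mono) (auto simp: K_def)
    then show ?thesis using * by (auto simp: K_def)
  qed
  have upper: "(g (fst p) - g (snd p))\<^sup>2 \<le> real n * (\<Sum>k\<in>{k \<in> K. sep k p}. (d k)\<^sup>2)" if p: "p \<in> Q" for p
  proof -
    have "(g (fst p) - g (snd p))\<^sup>2 \<le> real (card {k \<in> K. sep k p}) * (\<Sum>k\<in>{k \<in> K. sep k p}. (d k)\<^sup>2)"
    proof -
      \<comment> \<open>Cauchy-Schwarz for the sum of the gaps between the two positions.\<close>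
      have "0 \<le> (\<Sum>i\<in>{k \<in> K. sep k p}. \<Sum>j\<in>{k \<in> K. sep k p}. (d i - d j)\<^sup>2)"
        by (intro sum_nonneg) simp
      then show ?thesis using J[OF p] unfolding sum_pairwise_differences by simp
    qed
    also have "\<dots> \<le> real n * (\<Sum>k\<in>{k \<in> K. sep k p}. (d k)\<^sup>2)"
      using J[OF p] by (intro mult_right_mono) (auto intro: sum_nonneg)
    finally show ?thesis .
  qed
  have lower: "(\<Sum>k\<in>{k \<in> K. sep k p}. (d k)\<^sup>2) \<le> (g (fst p) - g (snd p))\<^sup>2" if p: "p \<in> Q" for p
    using J[OF p] sum_squares_le_square_sum[of "{k \<in> K. sep k p}" d] d0 by (auto simp: K_def)
  \<comment> \<open>The inequality \<open>4 * a * b \<le> (a + b)\<^sup>2\<close> for the numbers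
    \<open>a\<close> and \<open>b\<close> of positions on the two sides of gap \<open>k\<close>,
    where \<open>a + b = n\<close>.\<close>
  have count: "4 * ((1 + real k) * (real n - 1 - real k)) \<le> (real n)\<^sup>2" for k
    using zero_le_power2[of "real n - 2 - 2 * real k"] by (simp add: power2_eq_square algebra_simps)
  have cardQ: "2 * real (card {p \<in> Q. sep k p}) \<le> (real n)\<^sup>2" if k: "k \<in> K" for k
  proof -
    have "{p \<in> Q. sep k p} = {..k} \<times> {k<..<n} \<union> {k<..<n} \<times> {..k}"
      using k by (auto simp: Q_def sep_def K_def)
    then have "card {p \<in> Q. sep k p} \<le> 2 * (Suc k * (n - Suc k))"
      using card_Un_le[of "{..k} \<times> {k<..<n}" "{k<..<n} \<times> {..k}"] by (simp add: card_cartesian_product mult.commute)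
    then have "real (card {p \<in> Q. sep k p}) \<le> real (2 * (Suc k * (n - Suc k)))"
      by (simp only: of_nat_le_iff)
    also have "\<dots> = 2 * (real (Suc k) * real (n - Suc k))"
      by (simp only: of_nat_mult of_nat_numeral)
    also have "real (n - Suc k) = real n - 1 - real k"
      using k by (simp add: K_def of_nat_diff)
    finally show ?thesis using count[of k] by (simp only: of_nat_Suc)
  qed
  have cardF: "2 \<le> card {p \<in> F. sep k p}" if k: "k \<in> K" for k
  proof -
    obtain i j where ij: "(i, j) \<in> F" "i \<le> k" "k < j" using cross[of k] k by (auto simp: K_def less_diff_conv)
    then have "{(i, j), (j, i)} \<subseteq> {p \<in> F. sep k p}" using symF by (auto simp: sep_def dest: symD)
    then have "card {(i, j), (j, i)} \<le> card {p \<in> F. sep k p}" using finF by (intro card_mono) auto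
    then show ?thesis using ij by simp
  qed
  have swap: "(\<Sum>p\<in>R. \<Sum>k\<in>{k \<in> K. sep k p}. (d k)\<^sup>2) = (\<Sum>k\<in>K. real (card {p \<in> R. sep k p}) * (d k)\<^sup>2)"
    if "finite R" for R
    using sum.swap_restrict[OF that, of K "\<lambda>p k. (d k)\<^sup>2" "\<lambda>p k. sep k p"] by (simp add: K_def)
  \<comment> \<open>Mean zero removes the square of the sum from the pairwise identity.\<close>
  have "2 * real n * (\<Sum>i<n. (g i)\<^sup>2) = (\<Sum>p\<in>Q. (g (fst p) - g (snd p))\<^sup>2)"
    using sum_pairwise_differences[of g "{..<n}"] zero
    by (simp add: Q_def sum.cartesian_product case_prod_unfold)
  also have "\<dots> \<le> (\<Sum>p\<in>Q. real n * (\<Sum>k\<in>{k \<in> K. sep k p}. (d k)\<^sup>2))"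
    by (rule sum_mono) (rule upper)
  also have "\<dots> = real n * (\<Sum>k\<in>K. real (card {p \<in> Q. sep k p}) * (d k)\<^sup>2)"
    by (simp add: swap[OF finQ] flip: sum_distrib_left)
  finally have "2 * (\<Sum>i<n. (g i)\<^sup>2) \<le> (\<Sum>k\<in>K. real (card {p \<in> Q. sep k p}) * (d k)\<^sup>2)"
    using False by simp
  then have "8 * (\<Sum>i<n. (g i)\<^sup>2) \<le> (\<Sum>k\<in>K. 2 * (2 * real (card {p \<in> Q. sep k p}) * (d k)\<^sup>2))"
    by (simp add: mult.assoc flip: sum_distrib_left)
  also have "\<dots> \<le> (\<Sum>k\<in>K. 2 * ((real n)\<^sup>2 * (d k)\<^sup>2))"
    by (intro sum_mono mult_left_mono mult_right_mono cardQ) auto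
  also have "\<dots> = (real n)\<^sup>2 * (\<Sum>k\<in>K. 2 * (d k)\<^sup>2)"
    by (simp add: mult_ac flip: sum_distrib_left)
  also have "(\<Sum>k\<in>K. 2 * (d k)\<^sup>2) \<le> (\<Sum>k\<in>K. real (card {p \<in> F. sep k p}) * (d k)\<^sup>2)"
    using cardF by (intro sum_mono mult_right_mono) auto
  also have "\<dots> = (\<Sum>p\<in>F. \<Sum>k\<in>{k \<in> K. sep k p}. (d k)\<^sup>2)" using swap[OF finF] by simp
  also have "\<dots> \<le> (\<Sum>p\<in>F. (g (fst p) - g (snd p))\<^sup>2)"
    by (rule sum_mono) (use lower F in \<open>auto simp: Q_def\<close>)
  finally show ?thesis by (simp add: case_prod_unfold mult_left_mono)
qed simp

text \<open>Turns a sum over arcs into a double sum over vertices, to which a numbering of the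
  vertices can be applied.\<close>

lemma sum_edges_within:
  assumes "finite S"
  shows "(\<Sum>(x, y)\<in>E \<inter> S \<times> S. h x y) = (\<Sum>x\<in>S. \<Sum>y\<in>S. if (x, y) \<in> E then h x y else 0)"
proof -
  have "(\<Sum>(x, y)\<in>E \<inter> S \<times> S. h x y) = (\<Sum>p\<in>S \<times> S. if p \<in> E then h (fst p) (snd p) else 0)"
    using assms by (intro sum.mono_neutral_cong_left) auto
  then show ?thesis by (simp add: sum.cartesian_product case_prod_unfold)
qed

text \<open>Number the vertices by increasing \<open>f\<close>. Each proper initial segment is left
  by an edge, so the monotone case applies. The constant is 8 because \<open>E\<close> contains each
  edge in both directions.\<close>

lemma poincare_connected:
  fixes f :: "'a \<Rightarrow> real"
  assumes symE: "sym E" and S: "connected_on E S" "finite S" and zero: "(\<Sum>x\<in>S. f x) = 0"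
  shows "8 * (\<Sum>x\<in>S. (f x)\<^sup>2) \<le> (real (card S))\<^sup>2 * (\<Sum>(x, y)\<in>E \<inter> S \<times> S. (f x - f y)\<^sup>2)"
proof -
  obtain ys where ys: "set ys = S" "distinct ys" using S finite_distinct_list by blast
  define xs where "xs = sort_key f ys"
  define n where "n = length xs"
  have xs: "set xs = S" "distinct xs" "sorted (map f xs)" using ys by (auto simp: xs_def)
  have n: "n = card S" using xs distinct_card n_def by metis
  have bij: "bij_betw ((!) xs) {..<n} S" using bij_betw_nth[OF xs(2)] xs(1) n_def by simp
  define g where "g i = f (xs ! i)" for i
  define F where "F = {(i, j). i < n \<and> j < n \<and> (xs ! i, xs ! j) \<in> E}"
  have reindex: "(\<Sum>x\<in>S. h x) = (\<Sum>i<n. h (xs ! i))" for h :: "'a \<Rightarrow> real"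
    using sum.reindex_bij_betw[OF bij, of h] by simp
  have "8 * (\<Sum>i<n. (g i)\<^sup>2) \<le> (real n)\<^sup>2 * (\<Sum>(i, j)\<in>F. (g i - g j)\<^sup>2)"
  proof (rule poincare_monotone)
    show "g i \<le> g j" if "i \<le> j" "j < n" for i j
      using sorted_nth_mono[OF xs(3), of i j] that by (simp add: g_def n_def)
    show "F \<subseteq> {..<n} \<times> {..<n}" by (auto simp: F_def)
    show "sym F" using symE by (auto simp: F_def sym_def)
    show "(\<Sum>i<n. g i) = 0" using zero by (simp add: reindex g_def)
    show "\<exists>i j. (i, j) \<in> F \<and> i \<le> k \<and> k < j" if k: "Suc k < n" for k
    proof -
      \<comment> \<open>The first \<open>k + 1\<close> vertices in the order of \<open>f\<close>; an
        edge leaving this set crosses gap \<open>k\<close>.\<close>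
      let ?A = "(!) xs ` {..k}"
      have "?A \<subseteq> S" using k xs n_def by fastforce
      moreover have "xs ! 0 \<in> ?A" by simp
      moreover have "xs ! Suc k \<in> S - ?A"
        using k xs(1,2) by (auto simp: n_def nth_eq_iff_index_eq)
      ultimately have "\<exists>u\<in>?A. \<exists>w\<in>S - ?A. (u, w) \<in> E"
        by (rule connected_on_crossing[OF S(1)])
      then obtain u w where uw: "u \<in> ?A" "w \<in> S - ?A" "(u, w) \<in> E" by blast
      then obtain i where i: "i \<le> k" "u = xs ! i" by auto
      obtain j where j: "j < n" "w = xs ! j" using uw xs(1) by (auto simp: in_set_conv_nth n_def)
      have "k < j" using uw(2) j by (meson DiffD2 atMost_iff image_eqI not_le_imp_less)
      then show ?thesis using i j uw(3) k by (intro exI[of _ i] exI[of _ j]) (simp add: F_def)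
    qed
  qed
  moreover have "(\<Sum>(i, j)\<in>F. (g i - g j)\<^sup>2) = (\<Sum>(x, y)\<in>E \<inter> S \<times> S. (f x - f y)\<^sup>2)"
  proof -
    have "F = F \<inter> {..<n} \<times> {..<n}" by (auto simp: F_def)
    then have "(\<Sum>(i, j)\<in>F. (g i - g j)\<^sup>2) = (\<Sum>i<n. \<Sum>j<n. if (i, j) \<in> F then (g i - g j)\<^sup>2 else 0)"
      using sum_edges_within[of "{..<n}" "\<lambda>i j. (g i - g j)\<^sup>2" F] by simp
    also have "\<dots> = (\<Sum>i<n. \<Sum>j<n. if (xs ! i, xs ! j) \<in> E then (f (xs ! i) - f (xs ! j))\<^sup>2 else 0)"
      by (intro sum.cong) (auto simp: F_def g_def)
    also have "\<dots> = (\<Sum>x\<in>S. \<Sum>y\<in>S. if (x, y) \<in> E then (f x - f y)\<^sup>2 else 0)"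
      by (simp only: reindex)
    finally show ?thesis using sum_edges_within[OF S(2), of "\<lambda>x y. (f x - f y)\<^sup>2" E] by simp
  qed
  ultimately show ?thesis by (simp add: reindex n g_def)
qed

text \<open>The inequalities of the parts add up: edges between different parts only contribute
  nonnegative terms on the right, and on a singleton mean zero makes the left side vanish.\<close>

lemma poincare_partition:
  fixes f :: "'a \<Rightarrow> real"
  assumes symE: "sym E" and fin: "finite V" and part: "partition_on V P" and s: "s > 0"
    and P: "\<And>T. T \<in> P \<Longrightarrow> connected_on E T \<and> (card T = 1 \<or> real (card T) \<le> s)"
    and zero: "\<And>T. T \<in> P \<Longrightarrow> (\<Sum>x\<in>T. f x) = 0"
  shows "8 * (\<Sum>x\<in>V. (f x)\<^sup>2) \<le> s\<^sup>2 * (\<Sum>(x, y)\<in>E \<inter> V \<times> V. (f x - f y)\<^sup>2)"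
proof -
  have finT: "finite T" if "T \<in> P" for T
    using part fin that unfolding partition_on_def by (meson Union_upper finite_subset)
  have disj: "T \<inter> T' = {}" if "T \<in> P" "T' \<in> P" "T \<noteq> T'" for T T'
    using part that unfolding partition_on_def disjoint_def by blast
  have finP: "finite P" using finite_elements[OF fin part] .
  have V: "V = \<Union>P" using part by (simp add: partition_on_def)
  have each: "8 * (\<Sum>x\<in>T. (f x)\<^sup>2) \<le> s\<^sup>2 * (\<Sum>(x, y)\<in>E \<inter> T \<times> T. (f x - f y)\<^sup>2)" if T: "T \<in> P" for T
  proof (cases "card T = 1")
    case True
    then obtain a where "T = {a}" by (auto simp: card_1_singleton_iff)
    then have "(\<Sum>x\<in>T. (f x)\<^sup>2) = 0" using zero[OF T] by simp
    then show ?thesis by (simp add: sum_nonneg case_prod_unfold)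
  next
    case False
    then have "(real (card T))\<^sup>2 \<le> s\<^sup>2" using P[OF T] by (intro power_mono) auto
    then have "(real (card T))\<^sup>2 * (\<Sum>(x, y)\<in>E \<inter> T \<times> T. (f x - f y)\<^sup>2)
        \<le> s\<^sup>2 * (\<Sum>(x, y)\<in>E \<inter> T \<times> T. (f x - f y)\<^sup>2)"
      by (intro mult_right_mono) (auto intro: sum_nonneg)
    then show ?thesis
      using poincare_connected[OF symE _ finT[OF T] zero[OF T]] P[OF T] by fastforce
  qed
  have "8 * (\<Sum>x\<in>V. (f x)\<^sup>2) = (\<Sum>T\<in>P. 8 * (\<Sum>x\<in>T. (f x)\<^sup>2))"
    unfolding V using finP finT disj
    by (subst sum.Union_disjoint) (auto simp: sum_distrib_left)
  also have "\<dots> \<le> (\<Sum>T\<in>P. s\<^sup>2 * (\<Sum>(x, y)\<in>E \<inter> T \<times> T. (f x - f y)\<^sup>2))"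
    by (rule sum_mono) (rule each)
  also have "\<dots> = s\<^sup>2 * (\<Sum>(x, y)\<in>(\<Union>T\<in>P. E \<inter> T \<times> T). (f x - f y)\<^sup>2)"
    using finP finT disj by (subst sum.UNION_disjoint) (fastforce simp: sum_distrib_left)+
  also have "\<dots> \<le> s\<^sup>2 * (\<Sum>(x, y)\<in>E \<inter> V \<times> V. (f x - f y)\<^sup>2)"
  proof (intro mult_left_mono sum_mono2)
    show "(\<Union>T\<in>P. E \<inter> T \<times> T) \<subseteq> E \<inter> V \<times> V" unfolding V by blast
    show "finite (E \<inter> V \<times> V)" using fin by simp
  qed auto
  finally show ?thesis .
qed

section \<open>The walk matrix as identity minus a scaled Laplacian, and the final estimate\<close>

section \<open>The regularised random walk\<close>

lemma out_degree_pair_graph: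
  "out_degree (with_proj H) v = card (parcs H `` {v})"
proof -
  have "out_arcs (with_proj H) v = Pair v ` (parcs H `` {v})"
    by (auto simp: out_arcs_def)
  then show ?thesis by (simp add: out_degree_def card_image inj_on_def)
qed

text \<open>Connectedness of a digraph is defined through its symmetric closure, which has the same
  reachability here because the arcs are already symmetric.\<close>

lemma (in pair_graph) connected_on_pverts:
  assumes "Digraph_Component.connected (with_proj G)"
  shows "connected_on (parcs G) (pverts G)"
  unfolding connected_on_def
proof (intro ballI)
  fix x y assume "x \<in> pverts G" "y \<in> pverts G"
  then have "x \<rightarrow>\<^sup>*\<^bsub>mk_symmetric (with_proj G)\<^esub> y"
    using assms unfolding Digraph_Component.connected_def by (auto simp: strongly_connected_def)
  then have "x \<rightarrow>\<^sup>*\<^bsub>with_proj G\<^esub> y"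
    using reachable_mk_symmetric_eq[OF sym_arcs] by simp
  then have "(x, y) \<in> (parcs G)\<^sup>*" using reachable_rtranclI by fastforce
  moreover have "parcs G \<inter> pverts G \<times> pverts G = parcs G"
    using in_arcsD1 in_arcsD2 by auto
  ultimately show "(x, y) \<in> (parcs G \<inter> pverts G \<times> pverts G)\<^sup>*" by simp
qed

lemma (in pair_graph) sym_parcs: "sym (parcs G)"
  using arcs_symmetric by (auto simp: sym_def)

lemma regularised_walk_matrix_carrier:
  "regularised_walk_matrix H vs \<in> carrier_mat (length vs) (length vs)"
  by (rule carrier_matI) (simp_all add: regularised_walk_matrix_def adjacency_matrix_def degree_matrix_def)

lemma (in pair_graph) regularised_walk_matrix_symmetric:
  "transpose_mat (regularised_walk_matrix G vs) = regularised_walk_matrix G vs"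
  by (rule eq_matI)
    (auto simp: regularised_walk_matrix_def adjacency_matrix_def degree_matrix_def dest: arcs_symmetric)

text \<open>Identity minus walk matrix is the graph Laplacian divided by the maximum degree, the
  loops cancelling. The factor 2 in the denominator compensates for each edge being two
  arcs.\<close>

lemma (in pair_graph) regularised_walk_matrix_quadratic_form:
  assumes vs: "distinct vs" "set vs = pverts G" and d: "max_degree G > 0"
    and x: "x \<in> carrier_vec (length vs)"
    and f: "\<And>i. i < length vs \<Longrightarrow> f (vs ! i) = x $ i"
  shows "x \<bullet> (regularised_walk_matrix G vs *\<^sub>v x) = x \<bullet> x
    - (\<Sum>(u, v)\<in>parcs G \<inter> pverts G \<times> pverts G. (f u - f v)\<^sup>2) / (2 * real (max_degree G))"
proof -
  define n where "n = length vs"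
  define \<delta> where "\<delta> = real (max_degree G)"
  have "\<delta> > 0" using d by (simp add: \<delta>_def)
  define a where "a i j = (if (vs ! i, vs ! j) \<in> parcs G then 1 else 0 :: real)" for i j
  define D where "D i = real (out_degree (with_proj G) (vs ! i))" for i
  have bij: "bij_betw ((!) vs) {..<n} (pverts G)" using bij_betw_nth[OF vs(1)] vs(2) n_def by simp
  have reindex: "(\<Sum>x\<in>pverts G. h x) = (\<Sum>i<n. h (vs ! i))" for h :: "'a \<Rightarrow> real"
    using sum.reindex_bij_betw[OF bij, of h] by simp
  have a_sym: "a i j = a j i" for i j using arcs_symmetric by (auto simp: a_def)
  have D: "D i = (\<Sum>j<n. a i j)" if "i < n" for i
  proof -
    have "D i = (\<Sum>v\<in>parcs G `` {vs ! i}. 1)" by (simp add: D_def out_degree_pair_graph)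
    also have "\<dots> = (\<Sum>v\<in>pverts G. if (vs ! i, v) \<in> parcs G then 1 else 0)"
      using pair_finite_verts in_arcsD2 by (intro sum.mono_neutral_cong_left) auto
    finally show ?thesis by (simp add: reindex a_def)
  qed
  have entry: "regularised_walk_matrix G vs $$ (i, j) = (a i j + (if i = j then \<delta> - D i else 0)) / \<delta>"
    if "i < n" "j < n" for i j
    using that by (simp add: regularised_walk_matrix_def adjacency_matrix_def degree_matrix_def
        a_def D_def \<delta>_def n_def)
  have carr: "regularised_walk_matrix G vs \<in> carrier_mat n n"
    using regularised_walk_matrix_carrier n_def by metis
  have edges: "(\<Sum>(u, v)\<in>parcs G \<inter> pverts G \<times> pverts G. (f u - f v)\<^sup>2)
      = 2 * (\<Sum>i<n. D i * (x $ i)\<^sup>2) - 2 * (\<Sum>i<n. \<Sum>j<n. a i j * (x $ i * x $ j))"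
  proof -
    have "(\<Sum>(u, v)\<in>parcs G \<inter> pverts G \<times> pverts G. (f u - f v)\<^sup>2)
        = (\<Sum>i<n. \<Sum>j<n. if (vs ! i, vs ! j) \<in> parcs G then (f (vs ! i) - f (vs ! j))\<^sup>2 else 0)"
      using sum_edges_within[OF pair_finite_verts, of "\<lambda>u v. (f u - f v)\<^sup>2" "parcs G"]
      by (simp only: reindex)
    \<comment> \<open>The second square carries \<open>a j i\<close> instead of
      \<open>a i j\<close>, so that exchanging the sums turns it into the first.\<close>
    also have "\<dots> = (\<Sum>i<n. \<Sum>j<n. a i j * (x $ i)\<^sup>2 + a j i * (x $ j)\<^sup>2 - 2 * (a i j * (x $ i * x $ j)))"
      using f a_sym by (intro sum.cong refl) (auto simp: a_def n_def power2_diff)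
    also have "\<dots> = (\<Sum>i<n. \<Sum>j<n. a i j * (x $ i)\<^sup>2) + (\<Sum>i<n. \<Sum>j<n. a j i * (x $ j)\<^sup>2)
        - 2 * (\<Sum>i<n. \<Sum>j<n. a i j * (x $ i * x $ j))"
      by (simp add: sum.distrib sum_subtractf sum_distrib_left)
    also have "(\<Sum>i<n. \<Sum>j<n. a j i * (x $ j)\<^sup>2) = (\<Sum>i<n. \<Sum>j<n. a i j * (x $ i)\<^sup>2)"
      by (rule sum.swap)
    also have "(\<Sum>i<n. \<Sum>j<n. a i j * (x $ i)\<^sup>2) = (\<Sum>i<n. D i * (x $ i)\<^sup>2)"
      by (intro sum.cong refl) (simp add: D sum_distrib_right)
    finally show ?thesis by simp
  qed
  have xx: "x \<bullet> x = (\<Sum>i<n. (x $ i)\<^sup>2)"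
    using x by (simp add: scalar_prod_def power2_eq_square atLeast0LessThan n_def)
  have "x \<bullet> (regularised_walk_matrix G vs *\<^sub>v x)
      = (\<Sum>i<n. x $ i * (\<Sum>j<n. (a i j + (if i = j then \<delta> - D i else 0)) / \<delta> * x $ j))"
    using x carr entry by (auto simp: scalar_prod_def atLeast0LessThan n_def intro!: sum.cong)
  also have "\<dots> = (\<Sum>i<n. ((\<Sum>j<n. a i j * (x $ i * x $ j)) + (\<delta> - D i) * (x $ i)\<^sup>2) / \<delta>)"
  proof (intro sum.cong refl)
    fix i assume "i \<in> {..<n}"
    then have i: "i < n" by simp
    have "(\<Sum>j<n. (a i j + (if i = j then \<delta> - D i else 0)) / \<delta> * x $ j)
        = (\<Sum>j<n. (a i j * x $ j) / \<delta> + (if i = j then (\<delta> - D i) * x $ i / \<delta> else 0))"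
      by (intro sum.cong refl) (simp add: add_divide_distrib distrib_right)
    also have "\<dots> = (\<Sum>j<n. a i j * x $ j) / \<delta> + (\<delta> - D i) * x $ i / \<delta>"
      using i by (simp add: sum.distrib sum_divide_distrib)
    finally show "x $ i * (\<Sum>j<n. (a i j + (if i = j then \<delta> - D i else 0)) / \<delta> * x $ j)
        = ((\<Sum>j<n. a i j * (x $ i * x $ j)) + (\<delta> - D i) * (x $ i)\<^sup>2) / \<delta>"
      by (simp add: sum_distrib_left add_divide_distrib distrib_left power2_eq_square mult_ac)
  qed
  also have "\<dots> = ((\<Sum>i<n. \<Sum>j<n. a i j * (x $ i * x $ j)) + \<delta> * (\<Sum>i<n. (x $ i)\<^sup>2)
      - (\<Sum>i<n. D i * (x $ i)\<^sup>2)) / \<delta>"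
    by (simp add: sum_divide_distrib[symmetric] sum.distrib sum_subtractf left_diff_distrib sum_distrib_left)
  finally show ?thesis
    unfolding edges xx \<delta>_def[symmetric] using \<open>\<delta> > 0\<close> by (simp add: field_simps)
qed

text \<open>The two factors are at most \<open>exp (j / d)\<close> and
  \<open>exp (- (j / d))\<close>. The exponent \<open>\<nu>\<close> is chosen with
  \<open>ln 16 = 4 * ln 2\<close> in mind: each doubling of \<open>x\<close> costs a factor
  \<open>exp (1 / (2 * (d - 1)))\<close>.\<close>

lemma power_shrink_bound:
  fixes x :: real
  assumes d: "d \<ge> 2" and x: "0 < x" "x \<le> 2 ^ j" and \<nu>: "\<nu> = 1 / ((real d - 1) * ln 16)"
  shows "x powr (2 * \<nu>) * ((1 - 1 / (2 * real d)) ^ j)\<^sup>2 \<le> 1"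
proof -
  have d1: "real d - 1 > 0" using d by simp
  have "ln (16 :: real) = 4 * ln 2" using ln_realpow[of "2 :: real" 4] by simp
  then have \<nu>2: "2 * \<nu> * ln 2 = 1 / (2 * (real d - 1))" using d1 by (simp add: \<nu> field_simps)
  have \<nu>0: "\<nu> \<ge> 0" using d1 by (simp add: \<nu>)
  have "x powr (2 * \<nu>) \<le> (2 ^ j) powr (2 * \<nu>)" using x \<nu>0 by (intro powr_mono2) auto
  also have "\<dots> = exp (2 * \<nu> * ln (2 ^ j))" by (simp add: powr_def)
  also have "2 * \<nu> * ln (2 ^ j) = real j * (2 * \<nu> * ln 2)" by (simp add: ln_realpow)
  also have "\<dots> = real j * (1 / (2 * (real d - 1)))" by (simp only: \<nu>2)
  \<comment> \<open>From \<open>d \<le> 2 * (d - 1)\<close>, which is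
    \<open>d \<ge> 2\<close>.\<close>
  also have "\<dots> \<le> real j / real d"
  proof -
    have "1 / (2 * (real d - 1)) \<le> 1 / real d" using d by (intro divide_left_mono) auto
    then show ?thesis using mult_left_mono[of _ _ "real j"] by fastforce
  qed
  finally have 1: "x powr (2 * \<nu>) \<le> exp (real j / real d)" by simp
  have r: "0 \<le> 1 - 1 / (2 * real d)" using d by (simp add: field_simps)
  have "1 - 1 / (2 * real d) \<le> exp (- 1 / (2 * real d))" using exp_ge_add_one_self[of "- 1 / (2 * real d)"] by simp
  then have "((1 - 1 / (2 * real d)) ^ j)\<^sup>2 \<le> (exp (- 1 / (2 * real d)) ^ j)\<^sup>2"
    using r by (intro power_mono) auto
  also have "\<dots> = exp (- (real j / real d))"
    by (simp add: exp_of_nat_mult[symmetric] power_mult[symmetric] exp_double[symmetric] field_simps)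
  finally have "x powr (2 * \<nu>) * ((1 - 1 / (2 * real d)) ^ j)\<^sup>2 \<le> exp (real j / real d) * exp (- (real j / real d))"
    using 1 by (intro mult_mono) auto
  then show ?thesis by (simp add: exp_minus)
qed

theorem theorem1p11:
  fixes H :: "'a pair_pre_digraph" and vs :: "'a list" and N \<delta> B :: nat
    and \<beta> :: "nat \<Rightarrow> real" and \<nu> :: real
  assumes "pair_graph H" and "Digraph_Component.connected (with_proj H)"
    and "N = card (pverts H)" and "\<delta> = max_degree H" and "\<delta> \<ge> 2"
    and "distinct vs" and "set vs = pverts H"
    and "\<And>k. k \<in> {1..N} \<Longrightarrow>
           \<beta> k = eigenvalues_decreasing (regularised_walk_matrix H vs) ! (k - 1)"
    and "\<nu> = 1 / ((real \<delta> - 1) * ln 16)"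
    and "B \<in> {0..N - 2}"
  shows "\<beta> (B + 2) \<le> 1 - 4 / (real \<delta> * (real N)\<^sup>2) * ((real B + 1) / 2) powr (2 * \<nu>)"
proof -
  interpret pair_graph H by fact
  let ?A = "regularised_walk_matrix H vs"
  let ?E = "parcs H" and ?V = "pverts H"
  have N: "length vs = N" using assms(3,6,7) distinct_card by metis
  have A: "?A \<in> carrier_mat N N" using regularised_walk_matrix_carrier N by metis
  note symA = regularised_walk_matrix_symmetric[of vs]
  have con: "connected_on ?E ?V" by (rule connected_on_pverts[OF assms(2)])
  have deg: "finite (?E `` {x}) \<and> card (?E `` {x}) \<le> \<delta>" if "x \<in> ?V" for x
    using that pair_finite_arcs pair_finite_verts unfolding assms(4) max_degree_def
    by (auto simp flip: out_degree_pair_graph)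
  have "?V \<noteq> {}" using assms(2) by (auto simp: Digraph_Component.connected_def strongly_connected_def)
  then have "\<delta> \<in> out_degree (with_proj H) ` ?V"
    unfolding assms(4) max_degree_def using pair_finite_verts by (intro Max_in) auto
  then obtain v where v: "v \<in> ?V" "out_degree (with_proj H) v = \<delta>" by blast
  \<comment> \<open>Subtraction is truncated, so \<open>B \<le> N - 2\<close> yields
    \<open>B + 2 \<le> N\<close> only for \<open>N \<ge> 2\<close>; a vertex of degree
    \<open>\<delta> \<ge> 2\<close> guarantees this.\<close>
  have "N \<ge> 2"
  proof -
    have "?E `` {v} \<subseteq> ?V" using in_arcsD2 by auto
    then have "card (?E `` {v}) \<le> N" unfolding assms(3) using pair_finite_verts by (intro card_mono)
    then show ?thesis using v(2) assms(5) by (simp add: out_degree_pair_graph)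
  qed
  then have BN: "B + 2 \<le> N" using assms(10) by simp
  \<comment> \<open>The largest \<open>j\<close> for which the number of parts, at most
    \<open>2 ^ j\<close>, stays within \<open>B + 1\<close>; maximality gives
    \<open>(B + 1) / 2 < 2 ^ j\<close>, the source of the halved argument in the bound.\<close>
  obtain j where j: "2 ^ j \<le> B + 1" "B + 1 < 2 ^ (j + 1)"
    using ex_power_ivl1[of 2 "B + 1"] by auto
  define r where "r = (1 - 1 / (2 * real \<delta>)) ^ j"
  have r0: "r > 0" unfolding r_def using assms(5) by (intro zero_less_power) (simp add: field_simps)
  obtain P where P: "partition_on ?V P" "card P \<le> 2 ^ j"
    "\<And>T. T \<in> P \<Longrightarrow> connected_on ?E T \<and> (card T = 1 \<or> real (card T) \<le> r * real N)"
    using connected_partition[OF sym_parcs con pair_finite_verts \<open>?V \<noteq> {}\<close> deg, of j] assms(3,5)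
    unfolding r_def by auto
  obtain Ts where Ts: "set Ts = P" "distinct Ts"
    using finite_distinct_list[OF finite_elements[OF pair_finite_verts P(1)]] by blast
  \<comment> \<open>Indicator vectors of the parts: orthogonality to \<open>L i\<close> says that
    the mean over part \<open>i\<close> is zero.\<close>
  define L where "L i = vec N (\<lambda>k. if vs ! k \<in> Ts ! i then 1 else 0 :: real)" for i
  define c where "c = 1 - 4 / (real \<delta> * (r * real N)\<^sup>2)"
  have s0: "r * real N > 0" using r0 \<open>N \<ge> 2\<close> by simp
  have bij: "bij_betw ((!) vs) {..<N} ?V" using bij_betw_nth[OF assms(6)] assms(7) N by simp
  have reindex: "(\<Sum>x\<in>?V. h x) = (\<Sum>i<N. h (vs ! i))" for h :: "'a \<Rightarrow> real"
    using sum.reindex_bij_betw[OF bij, of h] by simp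
  note ev = eigenvalues_decreasing_real_symmetric[OF A symA]
  \<comment> \<open>Position \<open>B + 1\<close>, counted from 0, holds
    \<open>\<beta> (B + 2)\<close>, and the at most \<open>B + 1\<close> parts are just few enough
    constraints.\<close>
  have "eigenvalues_decreasing ?A ! (B + 1) \<le> c"
  proof (rule courant_fischer_upper[OF A symA ev])
    show "L i \<in> carrier_vec N" for i by (simp add: L_def)
    show "length Ts \<le> B + 1" using Ts P(2) j(1) distinct_card by fastforce
    show "B + 1 < N" using BN by simp
    fix x :: "real vec"
    assume x: "x \<in> carrier_vec N" and Lx: "\<And>i. i < length Ts \<Longrightarrow> L i \<bullet> x = 0"
    \<comment> \<open>The vector \<open>x\<close> read as a function on vertices; only its values on
      \<open>?V\<close> matter.\<close>
    define f where "f u = x $ inv_into {..<N} ((!) vs) u" for u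
    have f: "f (vs ! i) = x $ i" if "i < N" for i
      unfolding f_def using bij_betw_inv_into_left[OF bij] that by simp
    have zero: "(\<Sum>u\<in>T. f u) = 0" if T: "T \<in> P" for T
    proof -
      obtain i where i: "i < length Ts" "T = Ts ! i" using T Ts(1) by (metis in_set_conv_nth)
      have "T \<subseteq> ?V" using T P(1) by (auto simp: partition_on_def)
      then have "(\<Sum>u\<in>T. f u) = (\<Sum>u\<in>?V. if u \<in> T then f u else 0)"
        using pair_finite_verts by (intro sum.mono_neutral_cong_left) auto
      also have "\<dots> = L i \<bullet> x"
        unfolding reindex using x f i(2)
        by (auto simp: L_def scalar_prod_def atLeast0LessThan intro!: sum.cong)
      finally show ?thesis using Lx[OF i(1)] by simp
    qed
    let ?Q = "\<Sum>(u, v)\<in>?E \<inter> ?V \<times> ?V. (f u - f v)\<^sup>2"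
    have "8 * (\<Sum>u\<in>?V. (f u)\<^sup>2) \<le> (r * real N)\<^sup>2 * ?Q"
      by (rule poincare_partition[OF sym_parcs pair_finite_verts P(1) s0 P(3) zero])
    moreover have "(\<Sum>u\<in>?V. (f u)\<^sup>2) = x \<bullet> x"
      unfolding reindex using x f by (auto simp: scalar_prod_def power2_eq_square atLeast0LessThan)
    ultimately have "8 * (x \<bullet> x) / (r * real N)\<^sup>2 \<le> ?Q"
      by (simp add: pos_divide_le_eq[OF zero_less_power[OF s0]] mult.commute)
    \<comment> \<open>Dividing by \<open>2 * \<delta>\<close> turns the 8 for arcs into the 4 in
      \<open>c\<close> and matches the quadratic form of the walk.\<close>
    then have "8 * (x \<bullet> x) / (r * real N)\<^sup>2 / (2 * real \<delta>) \<le> ?Q / (2 * real \<delta>)"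
      by (rule divide_right_mono) simp
    moreover have "8 * (x \<bullet> x) / (r * real N)\<^sup>2 / (2 * real \<delta>) = (1 - c) * (x \<bullet> x)"
      by (simp add: c_def)
    moreover have "x \<bullet> (?A *\<^sub>v x) = x \<bullet> x - ?Q / (2 * real \<delta>)"
      using regularised_walk_matrix_quadratic_form[OF assms(6,7), of x f] x f N assms(4,5) by simp
    ultimately show "x \<bullet> (?A *\<^sub>v x) \<le> c * (x \<bullet> x)" by (simp add: algebra_simps)
  qed
  moreover have "\<beta> (B + 2) = eigenvalues_decreasing ?A ! (B + 1)" using assms(8)[of "B + 2"] BN by simp
  moreover have "c \<le> 1 - 4 / (real \<delta> * (real N)\<^sup>2) * ((real B + 1) / 2) powr (2 * \<nu>)"
  proof -
    have "real (B + 1) \<le> real (2 ^ (j + 1))" using j(2) by (simp only: of_nat_le_iff)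
    then have "(real B + 1) / 2 \<le> 2 ^ j" by simp
    then have "((real B + 1) / 2) powr (2 * \<nu>) * r\<^sup>2 \<le> 1"
      unfolding r_def using assms(5,9) by (intro power_shrink_bound) auto
    then have "((real B + 1) / 2) powr (2 * \<nu>) \<le> 1 / r\<^sup>2" using r0 by (simp add: pos_le_divide_eq)
    then have "4 / (real \<delta> * (real N)\<^sup>2) * ((real B + 1) / 2) powr (2 * \<nu>)
        \<le> 4 / (real \<delta> * (real N)\<^sup>2) * (1 / r\<^sup>2)" by (rule mult_left_mono) simp
    then show ?thesis by (simp add: c_def power_mult_distrib mult_ac)
  qed
  ultimately show ?thesis by simp
qed

end
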